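(* Consider the finite memory change-point model with a fixed $\kappa\ge0$, with $\Psi=\Psi_\alpha$ and $\pi_0$ allowed to depend on $\alpha\in(0,1)$, and let $z_0\in[K]^{t_0}$ (with $|z_0|=t_0\ge0$), $\Xi_1\in[K]^{\ell_1}$ and $\Xi_2\in[K]^{\ell_2}$ be an initial sequence and blocks, possibly depending on $\alpha$. Assume that there is a constant $c\in(0,1)$ such that $\sup_{t\ge0,z\in[K]^t}\pi_t(z;\alpha)\le1-c$ for all small enough $\alpha$, and that $\min\{\ell_1,\ell_2\}\ge\kappa$. If $\max\{\ell_1,\ell_2,|z_0|\}=O(1)$ as $\alpha\to0$, then as $\alpha\to0$ $$\max_{i=1,2}d(\Xi_i)=O(1),\quad\max_{i=1,2}M(\Xi_i,\epsilon)=o(|\log\alpha|)\ \text{for any }\epsilon\in(0,1),\quad\max_{i=1,2}\ell_i=O(|\log\alpha|),$$ $$|\log\zeta(\Xi_1)|+\log\widetilde\lambda(\Xi_1)=o(\lambda(z_0,\Xi_1)+|\log\alpha|).$$ In particular, if $z_0=z_0^*$, $\Xi_1=\Xi_1^*$ and $\Xi_2=\Xi_2^*$ are the optimal choices defined in the context, then the lengths of $z_0,\Xi_1$ and $\Xi_2$ are bounded by $K^\kappa$.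
   Context: Fix $2\le K<\infty$ and $[K]=\{1,\dots,K\}$. Finite memory change-point model: $\pi_0\in[0,1)$ is the prior probability that the change has occurred at time $0$; if treatments $x_1,x_2,\dots\in[K]$ are assigned, the conditional probability that the change occurs at time $t\ge1$ given it has not occurred before is $\pi_t(x_1,\dots,x_t)=\Psi(x_t,\mathbb S_{t-1})$, where $\mathbb S_t=\Phi(x_t,\mathbb S_{t-1})$, $\Phi(x,(x_\kappa,\dots,x_1))=(x,x_\kappa,\dots,x_2)$, $\mathbb S_0\in[K]^\kappa$ is a given initial state and $\Psi:[K]\times[K]^\kappa\to[0,1)$. Thus $\pi_t(x_1,\dots,x_t)=\Psi(x_t,x_{t-1},\dots,x_{t-\kappa})$, entries with non-positive index being taken from $\mathbb S_0$. A block of length $\ell$ is $\Xi\in[K]^\ell$, extended cyclically: $\Xi(j\ell+i)=\Xi(i)$ for every integer $j$, $1\le i\le\ell$; $\Xi(i:j)=(\Xi(i),\dots,\Xi(j))$; $|\Xi|=\ell$; $z_0(1:s)$ denotes the first $s$ entries of $z_0$. With $\omega(x)=|\log(1-x)|$: $d(\Xi)$ is the number such that for every $\epsilon>0$ there is a positive integer $M(\Xi,\epsilon)$ (take the smallest such) with $\sup_{t\ge0,z\in[K]^t,j\in[\ell]}|\frac1M\sum_{s=1}^M\omega(\pi_{t+s}(z,\Xi(j:s+j-1)))-d(\Xi)|\le\epsilon$ for all $M\ge M(\Xi,\epsilon)$; for the finite memory model it is $d(\Xi)=\frac1\ell\sum_{j=1}^\ell\omega(\Psi(\Xi(j),\Xi(j-1),\dots,\Xi(j-\kappa)))$.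 $\widetilde\lambda(\Xi)=\sup_{m\ge0,z\in[K]^m}\{1+\sum_{t\ge1}\prod_{s=1}^t(1-\pi_{m+s}(z,\Xi(1:s)))\}$; $\zeta(\Xi)=\inf_{t\ge0,z\in[K]^t,1\le j\le|\Xi|}\max_{1\le s\le2|\Xi|}\pi_{t+s}(z,\Xi(j:j+s-1))$; $$\lambda(z_0,\Xi)=(1-\pi_0)\Big[1+\sum_{t=1}^{t_0}\prod_{s=1}^t(1-\pi_s(z_0(1:s)))+\sum_{t=t_0+1}^\infty\prod_{s=1}^{t_0}(1-\pi_s(z_0(1:s)))\prod_{s=t_0+1}^t(1-\pi_s(z_0,\Xi(1:s-t_0)))\Big].$$ Optimal $z_0^*,\Xi_1^*$. Let $V^*(\mathbb S)=\inf_{(x_1,x_2,\dots)\in[K]^\infty}\sum_{t\ge1}\prod_{s=1}^t(1-\Psi(x_s,\mathbb S_{s-1}))$ with $\mathbb S_0=\mathbb S$, $\mathbb S_t=\Phi(x_t,\mathbb S_{t-1})$; $\upsilon^*(\mathbb S)\in\arg\min_{x\in[K]}(1-\Psi(x,\mathbb S))(1+V^*(\Phi(x,\mathbb S)))$. Starting from the model's initial state $\mathbb S_0^*=\mathbb S_0$, let $x_t^*=\upsilon^*(\mathbb S_{t-1}^* )$, $\mathbb S_t^*=\Phi(x_t^*,\mathbb S_{t-1}^* )$; $u^*=\inf\{t\ge1:\mathbb S_t^*=\mathbb S_\ell^*\text{ for some }0\le\ell<t\}$, $\ell^*\in[0,u^* )$ the integer with $\mathbb S^*_{\ell^*}=\mathbb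 S^*_{u^*}$; $z_0^*=(x_1^*,\dots,x_{\ell^*}^* )$, $\Xi_1^*=(x^*_{\ell^*+1},\dots,x^*_{u^*})$. Optimal $\Xi_2^*$. For each $x\in[K]$ let $I_x=\int\log(g_x/f_x)g_x\,d\mu\in(0,\infty)$ be the Kullback-Leibler divergence between the post-change response density $g_x$ and the pre-change one $f_x$ (with respect to a common $\sigma$-finite measure $\mu$; not depending on $\alpha$). Let $r(x,\mathbb S)=I_x+\omega(\Psi(x,\mathbb S))$, and let $\lambda'\in\mathbb R$, $h':[K]^\kappa\to\mathbb R$ solve $\lambda'+h'(\mathbb S)=\max_{x\in[K]}[r(x,\mathbb S)+h'(\Phi(x,\mathbb S))]$ for all $\mathbb S\in[K]^\kappa$; $\upsilon'(\mathbb S)\in\arg\max_x[r(x,\mathbb S)+h'(\Phi(x,\mathbb S))]$. With $\mathbb S_0'=\mathbb S_0$, $x_t'=\upsilon'(\mathbb S_{t-1}')$, $\mathbb S_t'=\Phi(x_t',\mathbb S_{t-1}')$, let $u'=\inf\{t\ge1:\mathbb S_t'=\mathbb S_\ell'\text{ for some }0\le\ell<t\}$, $\ell'\in[0,u')$ with $\mathbb S'_{\ell'}=\mathbb S'_{u'}$, and $\Xi_2^*=(x'_{\ell'+1},\dots,x'_{u'})$. Asymptotic notation (limits as $\alpha\to0$): $x=o(y)$ if $x/y\to0$; $x=O(y)$ if $\limsup x/y<\infty$. *)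

theory Defs
  imports "HOL-Analysis.Analysis" "HOL-Library.Landau_Symbols"
begin

text \<open>
  Treatments are the natural numbers in \<open>{1..K}\<close>, and a finite treatment sequence
  \<open>(x\<^sub>1, \<dots>, x\<^sub>t)\<close> is a list in chronological order, so that \<open>lists {1..K}\<close> is the union of
  the \<open>[K]\<^sup>t\<close> over \<open>t \<ge> 0\<close>.  A change-point model is a function \<open>\<pi>\<close> on such lists:
  \<open>\<pi> [x\<^sub>1, \<dots>, x\<^sub>t]\<close> is the conditional change probability at time \<open>t\<close>, and \<open>\<pi> []\<close> is the prior
  probability \<open>\<pi>\<^sub>0\<close>.  Memory states are lists with the most recent treatment first.
\<close>

section \<open>The finite memory model\<close>

definition states :: "nat \<Rightarrow> nat \<Rightarrow> nat list set" where
  "states K \<kappa> = {S \<in> lists {1..K}. length S = \<kappa>}"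

text \<open>For \<open>\<kappa> = 0\<close> this gives \<open>push x [] = []\<close>, as it should.\<close>

definition push :: "nat \<Rightarrow> nat list \<Rightarrow> nat list" where
  "push x S = butlast (x # S)"

definition state_after :: "nat list \<Rightarrow> nat list \<Rightarrow> nat list" where
  "state_after S0 xs = fold push xs S0"

definition finite_memory ::
  "real \<Rightarrow> (nat \<Rightarrow> nat list \<Rightarrow> real) \<Rightarrow> nat list \<Rightarrow> nat list \<Rightarrow> real" where
  "finite_memory \<pi>0 \<Psi> S0 xs =
     (if xs = [] then \<pi>0 else \<Psi> (last xs) (state_after S0 (butlast xs)))"

section \<open>Blocks\<close>

text \<open>Positions of a block are counted from 1; only positions \<open>i \<ge> 1\<close> are ever used.\<close>

definition cyc :: "nat list \<Rightarrow> nat \<Rightarrow> nat" where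
  "cyc \<Xi> i = \<Xi> ! ((i - 1) mod length \<Xi>)"

definition seg :: "nat list \<Rightarrow> nat \<Rightarrow> nat \<Rightarrow> nat list" where
  "seg \<Xi> i j = map (cyc \<Xi>) [i..<Suc j]"

definition \<omega> :: "real \<Rightarrow> real" where
  "\<omega> x = \<bar>ln (1 - x)\<bar>"

definition block_dev :: "nat \<Rightarrow> (nat list \<Rightarrow> real) \<Rightarrow> nat list \<Rightarrow> real \<Rightarrow> nat \<Rightarrow> ereal" where
  "block_dev K \<pi> \<Xi> d M =
     (SUP (z, j) \<in> lists {1..K} \<times> {1..length \<Xi>}.
        ereal \<bar>(1 / real M) * (\<Sum>s = 1..M. \<omega> (\<pi> (z @ seg \<Xi> j (s + j - 1)))) - d\<bar>)"

definition block_d :: "nat \<Rightarrow> (nat list \<Rightarrow> real) \<Rightarrow> nat list \<Rightarrow> real" where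
  "block_d K \<pi> \<Xi> =
     (THE d. \<forall>\<epsilon>>0. \<exists>N\<ge>1. \<forall>M\<ge>N. block_dev K \<pi> \<Xi> d M \<le> ereal \<epsilon>)"

definition block_M :: "nat \<Rightarrow> (nat list \<Rightarrow> real) \<Rightarrow> nat list \<Rightarrow> real \<Rightarrow> nat" where
  "block_M K \<pi> \<Xi> \<epsilon> =
     (LEAST N. 1 \<le> N \<and> (\<forall>M\<ge>N. block_dev K \<pi> \<Xi> (block_d K \<pi> \<Xi>) M \<le> ereal \<epsilon>))"

text \<open>The series below are over \<open>t = Suc n\<close> and \<open>t = t\<^sub>0 + Suc n\<close>, and may diverge to infinity.\<close>

definition block_lambda_tilde :: "nat \<Rightarrow> (nat list \<Rightarrow> real) \<Rightarrow> nat list \<Rightarrow> ennreal" where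
  "block_lambda_tilde K \<pi> \<Xi> =
     (SUP z \<in> lists {1..K}.
        1 + (\<Sum>n. ennreal (\<Prod>s = 1..Suc n. 1 - \<pi> (z @ seg \<Xi> 1 s))))"

definition block_zeta :: "nat \<Rightarrow> (nat list \<Rightarrow> real) \<Rightarrow> nat list \<Rightarrow> real" where
  "block_zeta K \<pi> \<Xi> =
     (INF (z, j) \<in> lists {1..K} \<times> {1..length \<Xi>}.
        Max ((\<lambda>s. \<pi> (z @ seg \<Xi> j (j + s - 1))) ` {1..2 * length \<Xi>}))"

definition block_lambda :: "(nat list \<Rightarrow> real) \<Rightarrow> nat list \<Rightarrow> nat list \<Rightarrow> ennreal" where
  "block_lambda \<pi> z0 \<Xi> = (let t0 = length z0 in
     ennreal (1 - \<pi> []) *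
       (1 + (\<Sum>t = 1..t0. ennreal (\<Prod>s = 1..t. 1 - \<pi> (take s z0)))
          + (\<Sum>n. ennreal ((\<Prod>s = 1..t0. 1 - \<pi> (take s z0)) *
                (\<Prod>s = t0 + 1..t0 + Suc n. 1 - \<pi> (z0 @ seg \<Xi> 1 (s - t0)))))))"

section \<open>Extended-real asymptotics\<close>

text \<open>
  \<open>block_zeta\<close> may vanish and \<open>block_lambda_tilde\<close>, \<open>block_lambda\<close> may be infinite, so the
  logarithm is taken with \<open>log 0 = -\<infinity>\<close> (unlike \<open>ln 0 = 0\<close>) and \<open>log \<infinity> = \<infinity>\<close>.
\<close>

definition log_ereal :: "ereal \<Rightarrow> ereal" where
  "log_ereal x =
     (if x = \<infinity> then \<infinity> else if x \<le> 0 then -\<infinity> else ereal (ln (real_of_ereal x)))"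

text \<open>
  The definition of \<open>smallo\<close> for extended-real functions.  When \<open>g\<close> is finite and nonzero it
  says that \<open>f / g\<close> tends to 0; where \<open>g\<close> is infinite it imposes nothing.
\<close>

definition smallo_ereal :: "'a filter \<Rightarrow> ('a \<Rightarrow> ereal) \<Rightarrow> ('a \<Rightarrow> ereal) \<Rightarrow> bool" where
  "smallo_ereal F f g \<longleftrightarrow> (\<forall>\<epsilon>::real>0. \<forall>\<^sub>F x in F. \<bar>f x\<bar> \<le> ereal \<epsilon> * \<bar>g x\<bar>)"

section \<open>Optimal initial sequence and blocks\<close>

definition Vstar :: "nat \<Rightarrow> (nat \<Rightarrow> nat list \<Rightarrow> real) \<Rightarrow> nat list \<Rightarrow> ennreal" where
  "Vstar K \<Psi> S =
     (INF x \<in> {x :: nat \<Rightarrow> nat. \<forall>t\<ge>1. x t \<in> {1..K}}.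
        \<Sum>n. ennreal (\<Prod>s = 1..Suc n. 1 - \<Psi> (x s) (state_after S (map x [1..<s]))))"

definition opt_delay_policy ::
  "nat \<Rightarrow> nat \<Rightarrow> (nat \<Rightarrow> nat list \<Rightarrow> real) \<Rightarrow> (nat list \<Rightarrow> nat) \<Rightarrow> bool" where
  "opt_delay_policy K \<kappa> \<Psi> \<upsilon> \<longleftrightarrow>
     (\<forall>S \<in> states K \<kappa>.
        is_arg_min (\<lambda>x. ennreal (1 - \<Psi> x S) * (1 + Vstar K \<Psi> (push x S)))
          (\<lambda>x. x \<in> {1..K}) (\<upsilon> S))"

text \<open>
  Kullback-Leibler divergence \<open>\<integral> log (g / f) g d\<mu>\<close>; the integrand is 0 where \<open>g = 0\<close>, and the
  points with \<open>f = 0 < g\<close> have to be excluded separately (there the divergence is infinite).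
\<close>

definition KL_info :: "'y measure \<Rightarrow> ('y \<Rightarrow> real) \<Rightarrow> ('y \<Rightarrow> real) \<Rightarrow> real" where
  "KL_info \<mu> g f = (LINT y|\<mu>. ln (g y / f y) * g y)"

definition is_density :: "'y measure \<Rightarrow> ('y \<Rightarrow> real) \<Rightarrow> bool" where
  "is_density \<mu> f \<longleftrightarrow>
     f \<in> borel_measurable \<mu> \<and> (\<forall>y \<in> space \<mu>. 0 \<le> f y) \<and> (\<integral>\<^sup>+ y. ennreal (f y) \<partial>\<mu>) = 1"

definition finite_pos_KL :: "'y measure \<Rightarrow> ('y \<Rightarrow> real) \<Rightarrow> ('y \<Rightarrow> real) \<Rightarrow> bool" where
  "finite_pos_KL \<mu> g f \<longleftrightarrow>
     (AE y in \<mu>. f y = 0 \<longrightarrow> g y = 0) \<and>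
     integrable \<mu> (\<lambda>y. ln (g y / f y) * g y) \<and> 0 < KL_info \<mu> g f"

definition opt_average_policy ::
  "nat \<Rightarrow> nat \<Rightarrow> (nat \<Rightarrow> real) \<Rightarrow> (nat \<Rightarrow> nat list \<Rightarrow> real) \<Rightarrow> real \<Rightarrow> (nat list \<Rightarrow> real) \<Rightarrow>
   (nat list \<Rightarrow> nat) \<Rightarrow> bool" where
  "opt_average_policy K \<kappa> I \<Psi> lam' h' \<upsilon> \<longleftrightarrow>
     (let r = (\<lambda>x S. I x + \<omega> (\<Psi> x S)) in
      \<forall>S \<in> states K \<kappa>.
        lam' + h' S = Max ((\<lambda>x. r x S + h' (push x S)) ` {1..K}) \<and>
        is_arg_max (\<lambda>x. r x S + h' (push x S)) (\<lambda>x. x \<in> {1..K}) (\<upsilon> S))"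

primrec traj :: "(nat list \<Rightarrow> nat) \<Rightarrow> nat list \<Rightarrow> nat \<Rightarrow> nat list" where
  "traj \<upsilon> S0 0 = S0"
| "traj \<upsilon> S0 (Suc t) = push (\<upsilon> (traj \<upsilon> S0 t)) (traj \<upsilon> S0 t)"

text \<open>The treatment \<open>x\<^sub>t = \<upsilon>(S\<^sub>t\<^sub>-\<^sub>1)\<close>, for \<open>t \<ge> 1\<close>.\<close>

definition traj_treatment :: "(nat list \<Rightarrow> nat) \<Rightarrow> nat list \<Rightarrow> nat \<Rightarrow> nat" where
  "traj_treatment \<upsilon> S0 t = \<upsilon> (traj \<upsilon> S0 (t - 1))"

definition loop_end :: "(nat list \<Rightarrow> nat) \<Rightarrow> nat list \<Rightarrow> nat" where
  "loop_end \<upsilon> S0 = (LEAST t. 1 \<le> t \<and> (\<exists>l<t. traj \<upsilon> S0 t = traj \<upsilon> S0 l))"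

definition loop_start :: "(nat list \<Rightarrow> nat) \<Rightarrow> nat list \<Rightarrow> nat" where
  "loop_start \<upsilon> S0 =
     (THE l. l < loop_end \<upsilon> S0 \<and> traj \<upsilon> S0 l = traj \<upsilon> S0 (loop_end \<upsilon> S0))"

definition loop_prefix :: "(nat list \<Rightarrow> nat) \<Rightarrow> nat list \<Rightarrow> nat list" where
  "loop_prefix \<upsilon> S0 = map (traj_treatment \<upsilon> S0) [1..<Suc (loop_start \<upsilon> S0)]"

definition loop_block :: "(nat list \<Rightarrow> nat) \<Rightarrow> nat list \<Rightarrow> nat list" where
  "loop_block \<upsilon> S0 =
     map (traj_treatment \<upsilon> S0) [Suc (loop_start \<upsilon> S0)..<Suc (loop_end \<upsilon> S0)]"

definition optimal_choice ::
  "nat \<Rightarrow> nat \<Rightarrow> (nat \<Rightarrow> real) \<Rightarrow> (nat \<Rightarrow> nat list \<Rightarrow> real) \<Rightarrow> nat list \<Rightarrow>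
   nat list \<Rightarrow> nat list \<Rightarrow> nat list \<Rightarrow> bool" where
  "optimal_choice K \<kappa> I \<Psi> S0 z0 \<Xi>1 \<Xi>2 \<longleftrightarrow>
     (\<exists>\<upsilon>. opt_delay_policy K \<kappa> \<Psi> \<upsilon> \<and> z0 = loop_prefix \<upsilon> S0 \<and> \<Xi>1 = loop_block \<upsilon> S0) \<and>
     (\<exists>lam' h' \<upsilon>'. opt_average_policy K \<kappa> I \<Psi> lam' h' \<upsilon>' \<and> \<Xi>2 = loop_block \<upsilon>' S0)"

end

theory Submission
  imports Defs
begin

text \<open>
  Since a block is at least as long as the memory, after one pass through it the change
  probabilities are periodic, whatever was assigned before.  Let \<open>p\<close> be the largest of them over one
  period.  Every window of one period contains a factor \<open>1 - p\<close> of the survival product, and all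
  later factors are at least \<open>1 - p\<close>; for bounded lengths this gives \<open>\<zeta> \<ge> p\<close>, an upper bound of order
  \<open>1 / p\<close> for \<open>\<lambda>\<close>-tilde and a lower bound of order \<open>1 / p\<close> for \<open>\<lambda>\<close>.  So the claim reduces to
  \<open>log (1 / p) \<le> \<epsilon> / p + O(1)\<close>, the constant being absorbed by \<open>\<bar>log \<alpha>\<bar>\<close>.  The averages of \<open>\<omega>\<close>
  differ from their limit only by the transient and an incomplete period, hence by \<open>O(1 / M)\<close>.
  The optimal trajectories repeat a state within \<open>K\<^sup>\<kappa>\<close> steps by the pigeonhole principle.
\<close>

section \<open>Sequences with eventual periodicity\<close>

lemma sum_window_periodic:
  fixes f :: "nat \<Rightarrow> 'a :: ab_group_add"
  assumes "\<And>n. f (n + l) = f n"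
  shows "(\<Sum>s = m..<m + l. f s) = (\<Sum>s<l. f s)"
proof (induction m)
  case (Suc m)
  have "(\<Sum>s = Suc m..<Suc m + l. f s) + f m = (\<Sum>s = m..<m + l. f s) + f (m + l)"
    by (metis add.commute add_Suc le_add1 sum.atLeastLessThan_Suc sum.atLeast_Suc_lessThan
        less_Suc_eq_le)
  then show ?case using Suc assms[of m] by simp
qed (simp add: atLeast0LessThan)

lemma abs_sum_le_of_window_sums_zero:
  fixes f :: "nat \<Rightarrow> real"
  assumes bound: "\<And>s. \<bar>f s\<bar> \<le> B"
    and window: "\<And>m. k \<le> m \<Longrightarrow> (\<Sum>s = m..<m + l. f s) = 0"
    and l: "0 < l"
  shows "\<bar>\<Sum>s<M. f s\<bar> \<le> real (k + l) * B"
proof (induction M rule: less_induct)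
  case (less M)
  show ?case
  proof (cases "M \<le> k + l")
    case True
    have "\<bar>\<Sum>s<M. f s\<bar> \<le> (\<Sum>s<M. B)"
      by (rule order_trans[OF sum_abs]) (intro sum_mono bound)
    also have "\<dots> = real M * B" by simp
    also have "\<dots> \<le> real (k + l) * B"
      using True bound[of 0] by (intro mult_right_mono) auto
    finally show ?thesis .
  next
    case False
    define m where "m = M - l"
    have m: "M = m + l" "k \<le> m" "m < M" using False l by (auto simp: m_def)
    have "(\<Sum>s<M. f s) = (\<Sum>s<m. f s) + (\<Sum>s = m..<m + l. f s)"
      unfolding m(1) by (simp add: lessThan_atLeast0 sum.atLeastLessThan_concat)
    then show ?thesis using less[OF m(3)] window[OF m(2)] by simp
  qed
qed

text \<open>
  Comparing the partial sum \<open>T\<^sub>N\<close> with \<open>T\<^bsub>N+l\<^esub> \<le> (l + k) + (1 - p) T\<^sub>N\<close> avoids splitting the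
  series into blocks.
\<close>

lemma sum_le_of_geometric_decay:
  fixes P :: "nat \<Rightarrow> real"
  assumes P: "\<And>n. 0 \<le> P n" "\<And>n. P n \<le> 1"
    and decay: "\<And>n. k \<le> n \<Longrightarrow> P (n + l) \<le> (1 - p) * P n"
    and p: "0 < p" "p \<le> 1"
  shows "(\<Sum>n<N. P n) \<le> real (k + l) / p"
proof -
  have step: "P (n + l) \<le> (1 - p) * P n + (if n < k then 1 else 0)" for n
    using decay[of n] P(2)[of "n + l"] P(1)[of n] p
    by (cases "n < k") (simp_all add: add_increasing)
  have "(\<Sum>n<N. P n) \<le> (\<Sum>n<N + l. P n)"
    by (intro sum_mono2) (auto simp: P)
  also have "\<dots> = (\<Sum>n<l. P n) + (\<Sum>n<N. P (n + l))"
    using sum.shift_bounds_nat_ivl[of P 0 l N] sum.atLeastLessThan_concat[of 0 l "N + l" P]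
    by (simp add: lessThan_atLeast0)
  also have "\<dots> \<le> (\<Sum>n<l. 1) + (\<Sum>n<N. (1 - p) * P n + (if n < k then 1 else 0))"
    by (intro add_mono sum_mono step P)
  also have "\<dots> = real l + (1 - p) * (\<Sum>n<N. P n) + real (card ({..<N} \<inter> {..<k}))"
    by (simp add: sum.distrib sum_distrib_left sum.If_cases lessThan_def)
  also have "\<dots> \<le> real l + (1 - p) * (\<Sum>n<N. P n) + real k"
    using card_mono[of "{..<k}" "{..<N} \<inter> {..<k}"] by simp
  finally show ?thesis using p by (simp add: field_simps)
qed

section \<open>Memory states\<close>

lemma push_eq_take: "push x S = take (length S) (x # S)"
  by (simp add: push_def butlast_conv_take)

lemma state_after_eq_take: "state_after S xs = take (length S) (rev xs @ S)"
proof (induction xs rule: rev_induct)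
  case (snoc x xs)
  have take: "take n (x # take n ys) = take n (x # ys)" for n ys
    by (cases n) (simp_all add: min_def)
  have "state_after S (xs @ [x]) = push x (state_after S xs)"
    by (simp add: state_after_def)
  also have "\<dots> = take (length S) (x # take (length S) (rev xs @ S))"
    by (simp add: push_eq_take snoc del: take_append)
  also have "\<dots> = take (length S) (x # rev xs @ S)"
    by (rule take)
  finally show ?case by simp
qed (simp add: state_after_def)

lemma push_in_states: "x \<in> {1..K} \<Longrightarrow> S \<in> states K \<kappa> \<Longrightarrow> push x S \<in> states K \<kappa>"
  unfolding push_eq_take states_def using set_take_subset[of "length S" "x # S"] by fastforce

lemma state_after_in_states:
  "S \<in> states K \<kappa> \<Longrightarrow> xs \<in> lists {1..K} \<Longrightarrow> state_after S xs \<in> states K \<kappa>"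
  unfolding state_after_eq_take states_def by (auto dest: in_set_takeD)

lemma finite_states: "finite (states K \<kappa>)" and card_states: "card (states K \<kappa>) = K ^ \<kappa>"
proof -
  have "states K \<kappa> = {xs. set xs \<subseteq> {1..K} \<and> length xs = \<kappa>}"
    by (auto simp: states_def)
  then show "finite (states K \<kappa>)" "card (states K \<kappa>) = K ^ \<kappa>"
    by (simp_all add: finite_lists_length_eq card_lists_length_eq)
qed

lemma finite_memory_append:
  assumes "length ys = Suc (length S0)"
  shows "finite_memory p0 \<Psi> S0 (xs @ ys) = \<Psi> (last ys) (rev (butlast ys))"
proof -
  have "ys \<noteq> []" using assms by auto
  then show ?thesis
    using assms by (simp add: finite_memory_def butlast_append state_after_eq_take)
qed

section \<open>Loops of a stationary policy\<close>

lemma traj_in_states: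
  assumes "S0 \<in> states K \<kappa>" "\<And>S. S \<in> states K \<kappa> \<Longrightarrow> \<upsilon> S \<in> {1..K}"
  shows "traj \<upsilon> S0 t \<in> states K \<kappa>"
  using assms by (induction t) (auto simp: push_in_states simp del: atLeastAtMost_iff)

lemma loop_lengths_le:
  assumes S0: "S0 \<in> states K \<kappa>" and \<upsilon>: "\<And>S. S \<in> states K \<kappa> \<Longrightarrow> \<upsilon> S \<in> {1..K}"
  shows "length (loop_prefix \<upsilon> S0) \<le> K ^ \<kappa>" "length (loop_block \<upsilon> S0) \<le> K ^ \<kappa>"
proof -
  define T where "T = traj \<upsilon> S0"
  define u where "u = loop_end \<upsilon> S0"
  define rep where "rep t \<longleftrightarrow> 1 \<le> t \<and> (\<exists>l<t. T t = T l)" for t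
  have u_eq: "u = (LEAST t. rep t)"
    by (simp add: u_def loop_end_def rep_def T_def)
  have "T ` {..K ^ \<kappa>} \<subseteq> states K \<kappa>"
    using traj_in_states[OF S0 \<upsilon>] by (auto simp: T_def)
  then have "card (T ` {..K ^ \<kappa>}) \<le> K ^ \<kappa>"
    using card_mono[OF finite_states] by (metis card_states)
  then have "\<not> inj_on T {..K ^ \<kappa>}"
    by (metis card_image card_atMost Suc_n_not_le_n)
  then obtain i j where "i < j" "j \<le> K ^ \<kappa>" "T j = T i"
    by (auto simp: inj_on_def) (metis linorder_neqE_nat)
  then have "rep j" by (auto simp: rep_def)
  then have rep_u: "rep u" and "u \<le> K ^ \<kappa>"
    unfolding u_eq using \<open>j \<le> K ^ \<kappa>\<close> by (auto intro: LeastI Least_le order_trans)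
  have inj: "a = b" if "a < u" "b < u" "T a = T b" for a b
  proof (rule ccontr)
    assume "a \<noteq> b"
    then have "rep (max a b)"
      using that(3) by (cases a b rule: linorder_cases) (auto simp: rep_def max_def intro!: exI)
    then show False using that(1,2) not_less_Least[of "max a b" rep] by (simp add: u_eq)
  qed
  obtain l where l: "l < u" "T u = T l" using rep_u by (auto simp: rep_def)
  have "loop_start \<upsilon> S0 = l"
    unfolding loop_start_def using l inj by (fold T_def u_def) (intro the_equality, auto)
  then show "length (loop_prefix \<upsilon> S0) \<le> K ^ \<kappa>" "length (loop_block \<upsilon> S0) \<le> K ^ \<kappa>"
    using l \<open>u \<le> K ^ \<kappa>\<close> by (auto simp: loop_prefix_def loop_block_def u_def)
qed

lemma optimal_choice_lengths_le:
  assumes S0: "S0 \<in> states K \<kappa>" and "optimal_choice K \<kappa> I \<Psi> S0 z0 \<Xi>1 \<Xi>2"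
  shows "length z0 \<le> K ^ \<kappa> \<and> length \<Xi>1 \<le> K ^ \<kappa> \<and> length \<Xi>2 \<le> K ^ \<kappa>"
proof -
  from assms(2) obtain \<upsilon> \<upsilon>' lam' h' where
    "opt_delay_policy K \<kappa> \<Psi> \<upsilon>" "opt_average_policy K \<kappa> I \<Psi> lam' h' \<upsilon>'"
    and eq: "z0 = loop_prefix \<upsilon> S0" "\<Xi>1 = loop_block \<upsilon> S0" "\<Xi>2 = loop_block \<upsilon>' S0"
    by (auto simp: optimal_choice_def)
  then have "\<upsilon> S \<in> {1..K}" "\<upsilon>' S \<in> {1..K}" if "S \<in> states K \<kappa>" for S
    using that
    by (auto simp: opt_delay_policy_def opt_average_policy_def is_arg_min_def is_arg_max_def Let_def)
  then show ?thesis unfolding eq by (intro conjI loop_lengths_le[OF S0])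
qed

section \<open>Segments of a cyclic block\<close>

lemma length_seg [simp]: "length (seg \<Xi> i j) = Suc j - i"
  unfolding seg_def length_map length_upt ..

lemma seg_append: "i \<le> j \<Longrightarrow> j \<le> Suc k \<Longrightarrow> 0 < j \<Longrightarrow> seg \<Xi> i (j - 1) @ seg \<Xi> j k = seg \<Xi> i k"
  unfolding seg_def map_append[symmetric]
  by (metis Suc_diff_1 upt_add_eq_append le_add_diff_inverse)

lemma cyc_periodic: "1 \<le> i \<Longrightarrow> cyc \<Xi> (i + k * length \<Xi>) = cyc \<Xi> i"
  unfolding cyc_def by (metis add.commute diff_add_assoc mod_mult_self1)

lemma seg_periodic:
  assumes "1 \<le> i"
  shows "seg \<Xi> (i + k * length \<Xi>) (j + k * length \<Xi>) = seg \<Xi> i j"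
proof -
  have "[i + m..<Suc (j + m)] = map (\<lambda>s. s + m) [i..<Suc j]" for m
    by (rule nth_equalityI) (simp_all del: upt_Suc)
  then show ?thesis using assms by (auto simp: seg_def cyc_periodic simp del: upt_Suc)
qed

lemma seg_in_lists:
  assumes "\<Xi> \<in> lists A" "\<Xi> \<noteq> []"
  shows "seg \<Xi> i j \<in> lists A"
  using assms by (auto simp: seg_def cyc_def)

locale finite_memory_block =
  fixes K \<kappa> :: nat and S0 :: "nat list" and p0 :: real and \<Psi> :: "nat \<Rightarrow> nat list \<Rightarrow> real"
    and c :: real and \<Xi> :: "nat list"
  assumes S0: "S0 \<in> states K \<kappa>"
    and p0: "0 \<le> p0"
    and Psi: "\<And>x S. x \<in> {1..K} \<Longrightarrow> S \<in> states K \<kappa> \<Longrightarrow> 0 \<le> \<Psi> x S"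
    and c: "0 < c" "c < 1"
    and le_c: "\<And>xs. xs \<in> lists {1..K} \<Longrightarrow> finite_memory p0 \<Psi> S0 xs \<le> 1 - c"
    and Xi: "\<Xi> \<in> lists {1..K}" "\<Xi> \<noteq> []"
    and len: "\<kappa> \<le> length \<Xi>"
begin

abbreviation pi where "pi \<equiv> finite_memory p0 \<Psi> S0"

abbreviation l where "l \<equiv> length \<Xi>"

text \<open>
  The change probability at block position \<open>n\<close> once the memory lies inside the block; the shift by
  two periods only keeps the positions positive.
\<close>

definition q :: "nat \<Rightarrow> real" where
  "q n = pi (seg \<Xi> (n + 2 * l - \<kappa>) (n + 2 * l))"

definition p :: real where "p = Max (q ` {..<l})"

lemma l_pos: "0 < l"
  using Xi by simp

lemma l_ge_1: "Suc 0 \<le> l"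
  using l_pos by linarith

lemma pi_nonneg: "xs \<in> lists {1..K} \<Longrightarrow> 0 \<le> pi xs"
proof (cases xs rule: rev_cases)
  case (snoc ys y)
  assume "xs \<in> lists {1..K}"
  then show ?thesis
    using snoc Psi state_after_in_states[OF S0, of ys] by (auto simp: finite_memory_def)
qed (simp add: finite_memory_def p0)

lemma seg_in [simp]: "z \<in> lists {1..K} \<Longrightarrow> z @ seg \<Xi> i j \<in> lists {1..K}"
  using seg_in_lists[OF Xi] by simp

lemma q_bounds: "0 \<le> q n" "q n \<le> 1 - c"
  unfolding q_def using seg_in_lists[OF Xi] by (blast intro: pi_nonneg le_c)+

lemma q_periodic: "q (n + l) = q n"
proof -
  have "seg \<Xi> (n + l + 2 * l - \<kappa>) (n + l + 2 * l)
      = seg \<Xi> ((n + 2 * l - \<kappa>) + 1 * l) ((n + 2 * l) + 1 * l)"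
    using len by (simp add: algebra_simps)
  also have "\<dots> = seg \<Xi> (n + 2 * l - \<kappa>) (n + 2 * l)"
    using len l_ge_1 by (intro seg_periodic) linarith
  finally show ?thesis by (simp add: q_def)
qed

lemma pi_eq_q:
  assumes "1 \<le> j" "j + \<kappa> \<le> n"
  shows "pi (z @ seg \<Xi> j n) = q n"
proof -
  have len0: "length S0 = \<kappa>" using S0 by (simp add: states_def)
  have "seg \<Xi> j n = seg \<Xi> j (n - \<kappa> - 1) @ seg \<Xi> (n - \<kappa>) n"
    using assms by (intro seg_append[symmetric]) auto
  then have "pi (z @ seg \<Xi> j n) = pi ([] @ seg \<Xi> (n - \<kappa>) n)"
    using assms finite_memory_append[of "seg \<Xi> (n - \<kappa>) n" S0 p0 \<Psi>]
    by (metis append.assoc len0 length_seg Suc_diff_le diff_diff_cancel diff_le_self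
        add_leD2)
  also have "seg \<Xi> (n - \<kappa>) n = seg \<Xi> (n - \<kappa> + 2 * l) (n + 2 * l)"
    using assms by (intro seg_periodic[symmetric]) auto
  finally show ?thesis using assms by (simp add: q_def)
qed

lemma q_mod: "q n = q (n mod l)"
proof (induction n rule: less_induct)
  case (less n)
  show ?case
  proof (cases "n < l")
    case False
    then have "q n = q (n - l)" using q_periodic[of "n - l"] by simp
    also have "\<dots> = q ((n - l) mod l)" using False l_pos by (intro less) linarith
    finally show ?thesis using False by (simp add: mod_if[of n])
  qed simp
qed

lemma q_le_p: "q n \<le> p"
  unfolding p_def using l_pos by (subst q_mod) (intro Max_ge, auto)

lemma p_attained: obtains n where "m \<le> n" "n < m + l" "q n = p"
proof -
  have "p \<in> q ` {..<l}" unfolding p_def using l_pos by (intro Max_in) auto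
  then obtain i where i: "i < l" "q i = p" by auto
  define a where "a = m mod l"
  define n where "n = (if a \<le> i then m - a + i else m - a + i + l)"
  have "a < l" "a \<le> m" using l_pos by (auto simp: a_def)
  then have "m \<le> n" "n < m + l" using i by (auto simp: n_def)
  moreover have "n mod l = i"
    using i by (simp add: n_def a_def minus_mod_eq_mult_div)
  ultimately show ?thesis using that i q_mod[of n] by metis
qed

lemma p_bounds: "0 \<le> p" "p \<le> 1 - c"
  using p_attained[of 0] q_bounds by metis+

section \<open>The average \<open>d\<close> and the threshold \<open>M\<close>\<close>

lemma omega_bounds:
  assumes "xs \<in> lists {1..K}"
  shows "0 \<le> \<omega> (pi xs)" "\<omega> (pi xs) \<le> - ln c"
proof -
  have "ln c \<le> ln (1 - pi xs)" "ln (1 - pi xs) \<le> 0"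
    using pi_nonneg[OF assms] le_c[OF assms] c by simp_all
  then show "0 \<le> \<omega> (pi xs)" "\<omega> (pi xs) \<le> - ln c" by (auto simp: \<omega>_def)
qed

lemma omega_q_bounds: "0 \<le> \<omega> (q n)" "\<omega> (q n) \<le> - ln c"
  unfolding q_def using seg_in_lists[OF Xi] by (blast intro: omega_bounds)+

definition d :: real where "d = (\<Sum>n<l. \<omega> (q n)) / real l"

lemma d_bounds: "0 \<le> d" "d \<le> - ln c"
proof -
  show "0 \<le> d" unfolding d_def by (intro divide_nonneg_nonneg sum_nonneg omega_q_bounds) simp
  have "(\<Sum>n<l. \<omega> (q n)) \<le> (\<Sum>n<l. - ln c)" by (intro sum_mono omega_q_bounds)
  then show "d \<le> - ln c" using l_pos by (simp add: d_def divide_le_eq mult.commute)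
qed

lemma average_deviation_le:
  assumes "z \<in> lists {1..K}" "1 \<le> j" "1 \<le> M"
  shows "\<bar>(1 / real M) * (\<Sum>s = 1..M. \<omega> (pi (z @ seg \<Xi> j (s + j - 1)))) - d\<bar>
           \<le> 2 * real l * (- ln c) / real M"
proof -
  define e where "e s = \<omega> (pi (z @ seg \<Xi> j (Suc s + j - 1))) - d" for s
  have "\<bar>e s\<bar> \<le> - ln c" for s
    using omega_bounds[OF seg_in[OF assms(1)], of j "Suc s + j - 1"] d_bounds
    unfolding e_def by linarith
  moreover have "(\<Sum>s = m..<m + l. e s) = 0" if "\<kappa> \<le> m" for m
  proof -
    have "(\<Sum>s = m..<m + l. e s) = (\<Sum>s = m..<m + l. \<omega> (q (s + j)) - d)"
      using that assms(2) by (intro sum.cong) (auto simp: e_def pi_eq_q)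
    also have "\<dots> = (\<Sum>s = m + j..<m + j + l. \<omega> (q s)) - real l * d"
      using sum.shift_bounds_nat_ivl[of "\<lambda>s. \<omega> (q s)" m j "m + l"]
      by (simp add: sum_subtractf ac_simps)
    also have "\<dots> = 0"
      using l_pos by (subst sum_window_periodic) (simp_all add: q_periodic d_def)
    finally show ?thesis .
  qed
  ultimately have "\<bar>\<Sum>s<M. e s\<bar> \<le> real (\<kappa> + l) * (- ln c)"
    using l_pos by (rule abs_sum_le_of_window_sums_zero)
  also have "\<dots> \<le> 2 * real l * (- ln c)"
    using len c by (intro mult_right_mono) auto
  finally have le: "\<bar>\<Sum>s<M. e s\<bar> \<le> 2 * real l * (- ln c)" .
  have "(\<Sum>s = 1..M. \<omega> (pi (z @ seg \<Xi> j (s + j - 1)))) = (\<Sum>s<M. e s) + real M * d"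
    by (simp add: e_def sum_subtractf sum.atLeast1_atMost_eq)
  then have "(1 / real M) * (\<Sum>s = 1..M. \<omega> (pi (z @ seg \<Xi> j (s + j - 1)))) - d
      = (\<Sum>s<M. e s) / real M"
    using assms(3) by (simp add: field_simps)
  then have "\<bar>(1 / real M) * (\<Sum>s = 1..M. \<omega> (pi (z @ seg \<Xi> j (s + j - 1)))) - d\<bar>
      = \<bar>\<Sum>s<M. e s\<bar> / real M"
    by simp
  also have "\<dots> \<le> 2 * real l * (- ln c) / real M"
    using le by (rule divide_right_mono) simp
  finally show ?thesis .
qed

lemma block_dev_le:
  assumes "1 \<le> M"
  shows "block_dev K pi \<Xi> d M \<le> ereal (2 * real l * (- ln c) / real M)"
  unfolding block_dev_def using assms
  by (intro SUP_least, unfold split_paired_all prod.case ereal_less_eq)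
    (rule average_deviation_le, auto)

lemma block_dev_small:
  assumes "0 < \<epsilon>"
  shows "1 \<le> nat \<lceil>2 * real l * (- ln c) / \<epsilon>\<rceil> + 1"
    and "\<forall>M\<ge>nat \<lceil>2 * real l * (- ln c) / \<epsilon>\<rceil> + 1. block_dev K pi \<Xi> d M \<le> ereal \<epsilon>"
proof -
  show "\<forall>M\<ge>nat \<lceil>2 * real l * (- ln c) / \<epsilon>\<rceil> + 1. block_dev K pi \<Xi> d M \<le> ereal \<epsilon>"
  proof (intro allI impI)
    fix M assume M: "nat \<lceil>2 * real l * (- ln c) / \<epsilon>\<rceil> + 1 \<le> M"
    then have "2 * real l * (- ln c) / \<epsilon> \<le> real M" by linarith
    then have "2 * real l * (- ln c) / real M \<le> \<epsilon>"
      using assms M by (simp add: field_simps)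
    then show "block_dev K pi \<Xi> d M \<le> ereal \<epsilon>"
      using block_dev_le[of M] M by (meson ereal_less_eq(3) order_trans le_add2)
  qed
qed simp

lemma block_d_eq: "block_d K pi \<Xi> = d"
  unfolding block_d_def
proof (rule the_equality)
  show "\<forall>\<epsilon>>0. \<exists>N\<ge>1. \<forall>M\<ge>N. block_dev K pi \<Xi> d M \<le> ereal \<epsilon>"
    using block_dev_small by blast
next
  fix d' assume d': "\<forall>\<epsilon>>0. \<exists>N\<ge>1. \<forall>M\<ge>N. block_dev K pi \<Xi> d' M \<le> ereal \<epsilon>"
  define a where "a M = (1 / real M) * (\<Sum>s = 1..M. \<omega> (pi ([] @ seg \<Xi> 1 (s + 1 - 1))))" for M
  have dev: "ereal \<bar>a M - x\<bar> \<le> block_dev K pi \<Xi> x M" for M x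
    unfolding block_dev_def a_def using l_ge_1
    by (intro SUP_upper2[of "([], 1)"]) auto
  have "\<bar>d' - d\<bar> \<le> \<epsilon> + \<epsilon>" if \<epsilon>: "0 < \<epsilon>" for \<epsilon>
  proof -
    obtain N where N: "\<forall>M\<ge>N. block_dev K pi \<Xi> d' M \<le> ereal \<epsilon>" using d' \<epsilon> by blast
    obtain N' where N': "\<forall>M\<ge>N'. block_dev K pi \<Xi> d M \<le> ereal \<epsilon>"
      using block_dev_small[OF \<epsilon>] by blast
    have "\<bar>a (max N N') - d'\<bar> \<le> \<epsilon>" "\<bar>a (max N N') - d\<bar> \<le> \<epsilon>"
      using N N' dev by (meson ereal_less_eq(3) order_trans max.cobounded1 max.cobounded2)+
    then show ?thesis by linarith
  qed
  from this[of "\<bar>d' - d\<bar> / 3"] show "d' = d" by fastforce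
qed

lemma block_M_le:
  assumes "0 < \<epsilon>"
  shows "real (block_M K pi \<Xi> \<epsilon>) \<le> 2 * real l * (- ln c) / \<epsilon> + 2"
proof -
  have "0 \<le> 2 * real l * (- ln c) / \<epsilon>"
    using assms c by (intro divide_nonneg_pos mult_nonneg_nonneg) auto
  moreover have "block_M K pi \<Xi> \<epsilon> \<le> nat \<lceil>2 * real l * (- ln c) / \<epsilon>\<rceil> + 1"
    unfolding block_M_def block_d_eq using block_dev_small[OF assms] by (intro Least_le) blast
  ultimately show ?thesis by linarith
qed

section \<open>Detection quantities in terms of the largest change probability\<close>

lemma block_zeta_bounds: "p \<le> block_zeta K pi \<Xi>" "block_zeta K pi \<Xi> \<le> 1"
proof -
  let ?m = "\<lambda>(z, j). Max ((\<lambda>s. pi (z @ seg \<Xi> j (j + s - 1))) ` {1..2 * l})"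
  let ?A = "lists {1..K} \<times> {1..l}"
  have mem: "([], 1) \<in> ?A" using l_pos by (auto simp: Suc_le_eq)
  have ge: "p \<le> ?m x" if xA: "x \<in> ?A" for x
  proof -
    obtain z j where x: "x = (z, j)" "z \<in> lists {1..K}" "1 \<le> j"
      using xA by (cases x) simp
    obtain n where n: "j + \<kappa> \<le> n" "n < j + \<kappa> + l" "q n = p" by (rule p_attained)
    define s where "s = n + 1 - j"
    have "pi (z @ seg \<Xi> j (j + s - 1)) = p" "s \<in> {1..2 * l}"
      using n x(3) len pi_eq_q[of j n z] by (auto simp: s_def)
    then show ?thesis unfolding x(1) prod.case by (intro Max_ge) (auto intro!: rev_image_eqI)
  qed
  show "p \<le> block_zeta K pi \<Xi>"
    unfolding block_zeta_def using mem ge by (intro cINF_greatest) blast+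
  have "block_zeta K pi \<Xi> \<le> ?m ([], 1)"
    unfolding block_zeta_def using ge mem by (intro cINF_lower bdd_belowI2[of _ p]) blast+
  also have "\<dots> \<le> 1"
  proof -
    have "pi ([] @ seg \<Xi> 1 (1 + s - 1)) \<le> 1" for s
      using le_c[OF seg_in[of "[]" 1 "1 + s - 1"]] c by simp
    moreover have "{1..2 * l} \<noteq> {}" using l_ge_1 by simp
    ultimately show ?thesis by simp
  qed
  finally show "block_zeta K pi \<Xi> \<le> 1" .
qed

lemma factor_bounds:
  assumes "z \<in> lists {1..K}"
  shows "c \<le> 1 - pi (z @ seg \<Xi> i s)" "1 - pi (z @ seg \<Xi> i s) \<le> 1"
  using le_c[OF seg_in[OF assms]] pi_nonneg[OF seg_in[OF assms]] by (auto simp: algebra_simps)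

lemma block_lambda_tilde_le:
  assumes "0 < p"
  shows "block_lambda_tilde K pi \<Xi> \<le> ennreal ((2 * real l + 1) / p)"
  unfolding block_lambda_tilde_def
proof (rule SUP_least)
  fix z assume z: "z \<in> lists {1..K}"
  define F where "F s = 1 - pi (z @ seg \<Xi> 1 s)" for s
  define P where "P n = (\<Prod>s = 1..Suc n. F s)" for n
  have F: "0 \<le> F s" "F s \<le> 1" for s
    using factor_bounds[OF z, of 1 s] c by (auto simp: F_def)
  have P: "0 \<le> P n" "P n \<le> 1" for n
    unfolding P_def by (intro prod_nonneg prod_le_1 conjI F)+
  have decay: "P (n + l) \<le> (1 - p) * P n" if "\<kappa> \<le> n" for n
  proof -
    obtain m where m: "Suc (Suc n) \<le> m" "m < Suc (Suc n) + l" "q m = p" by (rule p_attained)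
    have Fm: "F m = 1 - p" using m that pi_eq_q[of 1 m z] by (simp add: F_def)
    have "P (n + l) = P n * (\<Prod>s = Suc (Suc n)..Suc (n + l). F s)"
      unfolding P_def using prod.ub_add_nat[of 1 "Suc n" F l] by simp
    moreover have "(\<Prod>s = Suc (Suc n)..Suc (n + l). F s) \<le> 1 - p"
    proof -
      have "(\<Prod>s = Suc (Suc n)..Suc (n + l). F s)
          = F m * (\<Prod>s \<in> {Suc (Suc n)..Suc (n + l)} - {m}. F s)"
        using m by (intro prod.remove) auto
      also have "\<dots> \<le> F m * 1"
        by (intro mult_left_mono prod_le_1 F conjI)
      finally show ?thesis by (simp add: Fm)
    qed
    ultimately show ?thesis
      using P(1)[of n] by (simp add: mult_left_mono mult.commute[of "1 - p"])
  qed
  have "(\<Sum>n<N. P n) \<le> 2 * real l / p" for N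
  proof -
    have "(\<Sum>n<N. P n) \<le> real (\<kappa> + l) / p"
      using p_bounds c assms by (intro sum_le_of_geometric_decay[where k = \<kappa> and l = l] P decay)
        auto
    also have "\<dots> \<le> 2 * real l / p" using len assms by (intro divide_right_mono) auto
    finally show ?thesis .
  qed
  then have "(\<Sum>n<N. ennreal (P n)) \<le> ennreal (2 * real l / p)" for N
    by (simp add: sum_ennreal P ennreal_leI)
  then have "(\<Sum>n. ennreal (P n)) \<le> ennreal (2 * real l / p)"
    by (simp add: suminf_eq_SUP SUP_least)
  then have "1 + (\<Sum>n. ennreal (P n)) \<le> ennreal 1 + ennreal (2 * real l / p)"
    by (simp add: add_left_mono)
  also have "\<dots> = ennreal (1 + 2 * real l / p)"
    using assms by (intro ennreal_plus[symmetric]) auto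
  also have "\<dots> \<le> ennreal ((2 * real l + 1) / p)"
    using assms p_bounds c by (intro ennreal_leI) (simp add: field_simps)
  finally show "1 + (\<Sum>n. ennreal (\<Prod>s = 1..Suc n. 1 - pi (z @ seg \<Xi> 1 s)))
      \<le> ennreal ((2 * real l + 1) / p)"
    by (simp add: P_def F_def)
qed

lemma block_lambda_tilde_ge: "1 \<le> block_lambda_tilde K pi \<Xi>"
  unfolding block_lambda_tilde_def by (rule SUP_upper2[of "[]"]) auto

text \<open>Any upper bound \<open>r\<close> of \<open>p\<close> is admitted, so that \<open>p = 0\<close> is covered by letting \<open>r\<close> tend to 0.\<close>

lemma block_lambda_ge:
  assumes z: "z \<in> lists {1..K}" and r: "p \<le> r" "0 < r" "r \<le> 1 - c"
  shows "ennreal (c ^ (length z + l + 2) / r) \<le> block_lambda pi z \<Xi>"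
proof -
  define t where "t = length z"
  define F where "F s = 1 - pi (z @ seg \<Xi> 1 s)" for s
  define A where "A = (\<Prod>s = 1..t. 1 - pi (take s z))"
  have F: "c \<le> F s" for s using factor_bounds[OF z] by (simp add: F_def)
  have "c ^ t = (\<Prod>s = 1..t. c)" by simp
  also have "\<dots> \<le> A"
    unfolding A_def
  proof (intro prod_mono conjI)
    fix s
    have "take s z \<in> lists {1..K}" using z by (auto dest: in_set_takeD)
    then show "c \<le> 1 - pi (take s z)" using le_c by fastforce
  qed (use c in simp)
  finally have A: "c ^ t \<le> A" .
  have prodF: "c ^ min n \<kappa> * (1 - r) ^ n \<le> (\<Prod>s = 1..n. F s)" for n
  proof (induction n)
    case (Suc n)
    have r1: "0 \<le> 1 - r" "1 - r \<le> 1" using r c by auto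
    have "c ^ min (Suc n) \<kappa> * (1 - r) \<le> c ^ min n \<kappa> * F (Suc n)"
    proof (cases "n < \<kappa>")
      case True
      have "c * (1 - r) \<le> F (Suc n)"
        using mult_left_mono[OF r1(2), of c] c F[of "Suc n"] by linarith
      then show ?thesis using True c by (simp add: min_def mult.assoc)
    next
      case False
      have "1 - r \<le> F (Suc n)"
        using False pi_eq_q[of 1 "Suc n" z] q_le_p[of "Suc n"] r by (simp add: F_def)
      then have "c ^ \<kappa> * (1 - r) \<le> c ^ \<kappa> * F (Suc n)"
        using c by (intro mult_left_mono) auto
      moreover have "min (Suc n) \<kappa> = \<kappa>" "min n \<kappa> = \<kappa>" using False by auto
      ultimately show ?thesis by simp
    qed
    from mult_right_mono[OF this, of "(1 - r) ^ n"]
    have "c ^ min (Suc n) \<kappa> * (1 - r) ^ Suc n \<le> (c ^ min n \<kappa> * (1 - r) ^ n) * F (Suc n)"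
      using r1 by (simp add: ac_simps)
    also have "\<dots> \<le> (\<Prod>s = 1..n. F s) * F (Suc n)"
      using F[of "Suc n"] c by (intro mult_right_mono Suc) auto
    finally show ?case by simp
  qed simp
  have "c ^ t * (c ^ l * (1 - r) ^ Suc n) \<le> A * (\<Prod>s = 1..Suc n. F s)" for n
  proof (rule mult_mono[OF A])
    have "c ^ l \<le> c ^ min (Suc n) \<kappa>" using c len by (intro power_decreasing) auto
    then have "c ^ l * (1 - r) ^ Suc n \<le> c ^ min (Suc n) \<kappa> * (1 - r) ^ Suc n"
      using r c by (intro mult_right_mono zero_le_power) auto
    then show "c ^ l * (1 - r) ^ Suc n \<le> (\<Prod>s = 1..Suc n. F s)"
      using prodF by (rule order_trans)
    show "0 \<le> A" using A c by (meson order_trans zero_le_power less_imp_le)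
    show "0 \<le> c ^ l * (1 - r) ^ Suc n" using r c by simp
  qed
  moreover have "(\<Prod>s = t + 1..t + Suc n. 1 - pi (z @ seg \<Xi> 1 (s - t))) = (\<Prod>s = 1..Suc n. F s)" for n
    using prod.shift_bounds_cl_nat_ivl[of "\<lambda>s. 1 - pi (z @ seg \<Xi> 1 (s - t))" 1 t "Suc n"]
    by (simp add: F_def add.commute)
  ultimately have term_ge: "ennreal (c ^ (t + l) * (1 - r) ^ Suc n)
      \<le> ennreal (A * (\<Prod>s = t + 1..t + Suc n. 1 - pi (z @ seg \<Xi> 1 (s - t))))" for n
    by (intro ennreal_leI) (simp add: power_add mult.assoc)
  have "(\<lambda>n. (1 - r) ^ n) sums (1 / (1 - (1 - r)))"
    using r c by (intro geometric_sums) auto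
  then have "(\<lambda>n. c ^ (t + l) * (1 - r) * (1 - r) ^ n) sums (c ^ (t + l) * (1 - r) * (1 / r))"
    by (intro sums_mult) simp
  then have sums: "(\<lambda>n. c ^ (t + l) * (1 - r) ^ Suc n) sums (c ^ (t + l) * (1 - r) / r)"
    by (simp add: mult.assoc)
  have "c ^ (t + l) * c / r \<le> c ^ (t + l) * (1 - r) / r"
    using r c by (intro divide_right_mono mult_left_mono) auto
  then have "ennreal (c ^ (t + l) * c / r) \<le> ennreal (c ^ (t + l) * (1 - r) / r)"
    by (rule ennreal_leI)
  also have "\<dots> = (\<Sum>n. ennreal (c ^ (t + l) * (1 - r) ^ Suc n))"
    using sums r c by (intro suminf_ennreal_eq[symmetric]) auto
  also have "\<dots> \<le> (\<Sum>n. ennreal (A * (\<Prod>s = t + 1..t + Suc n. 1 - pi (z @ seg \<Xi> 1 (s - t)))))"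
    by (intro suminf_le term_ge) auto
  finally have series: "ennreal (c ^ (t + l) * c / r) \<le> \<dots>" .
  have "c \<le> 1 - pi []" using le_c[of "[]"] by simp
  then have "ennreal c * ennreal (c ^ (t + l) * c / r) \<le> block_lambda pi z \<Xi>"
    unfolding block_lambda_def Let_def
    by (fold t_def, fold A_def)
      (intro mult_mono ennreal_leI order_trans[OF series] add_increasing, auto)
  also have "ennreal c * ennreal (c ^ (t + l) * c / r) = ennreal (c ^ (t + l + 2) / r)"
    using c r by (simp add: ennreal_mult'[symmetric] ac_simps)
  finally show ?thesis by (simp add: t_def)
qed

lemma log_sum_le:
  assumes z: "z \<in> lists {1..K}"
    and L: "l \<le> L" "length z \<le> L"
    and \<epsilon>: "0 < \<epsilon>"
    and a: "ln (2 * real L + 1) - 2 * ln (\<epsilon> * c ^ (2 * L + 2) / 2) \<le> \<epsilon> * a" "0 \<le> a"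
  shows "\<bar>\<bar>log_ereal (ereal (block_zeta K pi \<Xi>))\<bar>
             + log_ereal (enn2ereal (block_lambda_tilde K pi \<Xi>))\<bar>
         \<le> ereal \<epsilon> * \<bar>enn2ereal (block_lambda pi z \<Xi>) + ereal a\<bar>"
proof -
  define \<eta> where "\<eta> = c ^ (2 * L + 2)"
  have \<eta>: "0 < \<eta>" using c by (simp add: \<eta>_def)
  have lam_ge: "ennreal (\<eta> / r) \<le> block_lambda pi z \<Xi>" if "p \<le> r" "0 < r" "r \<le> 1 - c" for r
  proof -
    have "\<eta> / r \<le> c ^ (length z + l + 2) / r"
      unfolding \<eta>_def using that c L by (intro divide_right_mono power_decreasing) auto
    then show ?thesis using block_lambda_ge[OF z that] by (meson ennreal_leI order_trans)
  qed
  show ?thesis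
  proof (cases "p = 0")
    case True
    have "block_lambda pi z \<Xi> = top"
    proof (rule ccontr)
      assume "block_lambda pi z \<Xi> \<noteq> top"
      then obtain x where x: "0 \<le> x" "block_lambda pi z \<Xi> = ennreal x"
        by (cases "block_lambda pi z \<Xi>") auto
      define r where "r = min (1 - c) (\<eta> / (x + 1))"
      have r: "0 < r" "r \<le> 1 - c" "r \<le> \<eta> / (x + 1)" using \<eta> c x by (auto simp: r_def)
      have "\<eta> / r \<le> x" using lam_ge[of r] r x True by simp
      then have "\<eta> \<le> x * r" using r by (simp add: divide_le_eq)
      also have "\<dots> \<le> x * (\<eta> / (x + 1))" using r x by (intro mult_left_mono)
      finally show False using x \<eta> by (simp add: field_simps)
    qed
    then show ?thesis using \<epsilon> by simp
  next
    case False
    then have p: "0 < p" using p_bounds by simp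
    define \<delta> where "\<delta> = \<epsilon> * \<eta> / 2"
    have \<delta>: "0 < \<delta>" using \<epsilon> \<eta> by (simp add: \<delta>_def)
    define \<zeta> where "\<zeta> = block_zeta K pi \<Xi>"
    have \<zeta>: "p \<le> \<zeta>" "\<zeta> \<le> 1" using block_zeta_bounds by (simp_all add: \<zeta>_def)
    have le: "block_lambda_tilde K pi \<Xi> \<le> ennreal ((2 * real L + 1) / p)"
      using L p by (intro order_trans[OF block_lambda_tilde_le[OF p]] ennreal_leI divide_right_mono) auto
    then obtain y where y0: "0 \<le> y" "block_lambda_tilde K pi \<Xi> = ennreal y"
      by (cases "block_lambda_tilde K pi \<Xi>") (auto simp: top_unique)
    have y: "1 \<le> y" "y \<le> (2 * real L + 1) / p"
      using block_lambda_tilde_ge le y0 p by (simp_all add: ennreal_le_iff)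
    have "- ln \<zeta> \<le> - ln p" using \<zeta> p by simp
    moreover have "ln y \<le> ln (2 * real L + 1) - ln p"
      using y p ln_mono[of y "(2 * real L + 1) / p"] by (simp add: ln_div)
    moreover have "\<bar>ln \<zeta>\<bar> = - ln \<zeta>" using \<zeta> p by simp
    ultimately have "\<bar>ln \<zeta>\<bar> + ln y \<le> ln (2 * real L + 1) - 2 * ln p"
      by linarith
    also have "\<dots> \<le> ln (2 * real L + 1) + 2 * (\<delta> / p - ln \<delta>)"
      using ln_le_minus_one[of "\<delta> / p"] \<delta> p by (simp add: ln_div)
    also have "\<dots> \<le> \<epsilon> * (\<eta> / p + a)"
      using a by (simp add: \<delta>_def \<eta>_def algebra_simps)
    finally have main: "\<bar>ln \<zeta>\<bar> + ln y \<le> \<epsilon> * (\<eta> / p + a)" .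
    have "ereal (\<eta> / p) \<le> enn2ereal (block_lambda pi z \<Xi>)"
      using lam_ge[of p] p p_bounds \<eta>
      by (metis enn2ereal_ennreal less_eq_ennreal.rep_eq divide_nonneg_pos less_imp_le order_refl)
    then have "ereal (\<eta> / p + a) \<le> enn2ereal (block_lambda pi z \<Xi>) + ereal a"
      by (metis add_right_mono plus_ereal.simps(1))
    also have "\<dots> \<le> \<bar>enn2ereal (block_lambda pi z \<Xi>) + ereal a\<bar>"
      using a by simp
    finally have "ereal \<epsilon> * ereal (\<eta> / p + a)
        \<le> ereal \<epsilon> * \<bar>enn2ereal (block_lambda pi z \<Xi>) + ereal a\<bar>"
      using \<epsilon> by (intro ereal_mult_left_mono) auto
    moreover have "\<bar>\<bar>log_ereal (ereal \<zeta>)\<bar> + log_ereal (enn2ereal (ennreal y))\<bar>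
        = ereal (\<bar>ln \<zeta>\<bar> + ln y)"
      using \<zeta> p y by (simp add: log_ereal_def enn2ereal_ennreal)
    ultimately show ?thesis
      unfolding y0 \<zeta>_def[symmetric] using main
      by (metis ereal_less_eq(3) times_ereal.simps(1) order_trans)
  qed
qed

end

theorem lemma6p1:
  fixes K \<kappa> :: nat
    and S0 :: "nat list"
    and \<Psi> :: "real \<Rightarrow> nat \<Rightarrow> nat list \<Rightarrow> real"
    and \<pi>0 :: "real \<Rightarrow> real"
    and \<pi> :: "real \<Rightarrow> nat list \<Rightarrow> real"
    and z0 \<Xi>1 \<Xi>2 :: "real \<Rightarrow> nat list"
    and c :: real
    and \<mu> :: "'y measure"
    and f g :: "nat \<Rightarrow> 'y \<Rightarrow> real"
  assumes K: "2 \<le> K"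
    and S0: "S0 \<in> states K \<kappa>"
    and pi0: "\<And>\<alpha>. \<alpha> \<in> {0<..<1} \<Longrightarrow> \<pi>0 \<alpha> \<in> {0..<1}"
    and Psi: "\<And>\<alpha> x S. \<alpha> \<in> {0<..<1} \<Longrightarrow> x \<in> {1..K} \<Longrightarrow> S \<in> states K \<kappa> \<Longrightarrow> \<Psi> \<alpha> x S \<in> {0..<1}"
    and model: "\<And>\<alpha>. \<alpha> \<in> {0<..<1} \<Longrightarrow> \<pi> \<alpha> = finite_memory (\<pi>0 \<alpha>) (\<Psi> \<alpha>) S0"
    and z0: "\<And>\<alpha>. \<alpha> \<in> {0<..<1} \<Longrightarrow> z0 \<alpha> \<in> lists {1..K}"
    and Xi1: "\<And>\<alpha>. \<alpha> \<in> {0<..<1} \<Longrightarrow> \<Xi>1 \<alpha> \<in> lists {1..K} \<and> \<Xi>1 \<alpha> \<noteq> []"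
    and Xi2: "\<And>\<alpha>. \<alpha> \<in> {0<..<1} \<Longrightarrow> \<Xi>2 \<alpha> \<in> lists {1..K} \<and> \<Xi>2 \<alpha> \<noteq> []"
    and mu: "sigma_finite_measure \<mu>"
    and densities: "\<And>x. x \<in> {1..K} \<Longrightarrow> is_density \<mu> (f x) \<and> is_density \<mu> (g x)"
    and KL: "\<And>x. x \<in> {1..K} \<Longrightarrow> finite_pos_KL \<mu> (g x) (f x)"
    and c: "0 < c" "c < 1"
    and sup_pi: "\<forall>\<^sub>F \<alpha> in at_right 0. (SUP xs \<in> lists {1..K}. \<pi> \<alpha> xs) \<le> 1 - c"
    and len: "\<And>\<alpha>. \<alpha> \<in> {0<..<1} \<Longrightarrow> \<kappa> \<le> min (length (\<Xi>1 \<alpha>)) (length (\<Xi>2 \<alpha>))"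
  shows
    "((\<lambda>\<alpha>. real (max (max (length (\<Xi>1 \<alpha>)) (length (\<Xi>2 \<alpha>))) (length (z0 \<alpha>))))
          \<in> O[at_right 0](\<lambda>_. 1) \<longrightarrow>
        (\<lambda>\<alpha>. max (block_d K (\<pi> \<alpha>) (\<Xi>1 \<alpha>)) (block_d K (\<pi> \<alpha>) (\<Xi>2 \<alpha>)))
          \<in> O[at_right 0](\<lambda>_. 1)
      \<and> (\<forall>\<epsilon> \<in> {0<..<1}.
          (\<lambda>\<alpha>. real (max (block_M K (\<pi> \<alpha>) (\<Xi>1 \<alpha>) \<epsilon>) (block_M K (\<pi> \<alpha>) (\<Xi>2 \<alpha>) \<epsilon>)))
            \<in> o[at_right 0](\<lambda>\<alpha>. \<bar>ln \<alpha>\<bar>))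
      \<and> (\<lambda>\<alpha>. real (max (length (\<Xi>1 \<alpha>)) (length (\<Xi>2 \<alpha>)))) \<in> O[at_right 0](\<lambda>\<alpha>. \<bar>ln \<alpha>\<bar>)
      \<and> smallo_ereal (at_right 0)
          (\<lambda>\<alpha>. \<bar>log_ereal (ereal (block_zeta K (\<pi> \<alpha>) (\<Xi>1 \<alpha>)))\<bar>
             + log_ereal (enn2ereal (block_lambda_tilde K (\<pi> \<alpha>) (\<Xi>1 \<alpha>))))
          (\<lambda>\<alpha>. enn2ereal (block_lambda (\<pi> \<alpha>) (z0 \<alpha>) (\<Xi>1 \<alpha>)) + ereal \<bar>ln \<alpha>\<bar>))
     \<and> (\<forall>\<alpha> \<in> {0<..<1}. \<forall>z0' \<Xi>1' \<Xi>2'.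
          optimal_choice K \<kappa> (\<lambda>x. KL_info \<mu> (g x) (f x)) (\<Psi> \<alpha>) S0 z0' \<Xi>1' \<Xi>2' \<longrightarrow>
          length z0' \<le> K ^ \<kappa> \<and> length \<Xi>1' \<le> K ^ \<kappa> \<and> length \<Xi>2' \<le> K ^ \<kappa>)"
proof (intro conjI impI ballI allI)
  let ?ev = "\<lambda>P. eventually P (at_right (0 :: real))"
  have in01: "?ev (\<lambda>\<alpha>. \<alpha> \<in> {0<..<1})"
    by (rule eventually_at_right_real) simp
  have blocks: "?ev (\<lambda>\<alpha>. finite_memory_block K \<kappa> S0 (\<pi>0 \<alpha>) (\<Psi> \<alpha>) c (\<Xi>1 \<alpha>) \<and>
      finite_memory_block K \<kappa> S0 (\<pi>0 \<alpha>) (\<Psi> \<alpha>) c (\<Xi>2 \<alpha>))"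
    using in01 sup_pi
  proof eventually_elim
    case (elim \<alpha>)
    have "\<pi> \<alpha> xs \<le> 1" if "xs \<in> lists {1..K}" for xs
    proof (cases xs rule: rev_cases)
      case Nil
      then show ?thesis using pi0[OF elim(1)] model[OF elim(1)] by (simp add: finite_memory_def)
    next
      case (snoc ys y)
      then have "y \<in> {1..K}" "state_after S0 ys \<in> states K \<kappa>"
        using that state_after_in_states[OF S0, of ys] by auto
      then show ?thesis
        using Psi[OF elim(1), of y "state_after S0 ys"] model[OF elim(1)] snoc
        by (simp add: finite_memory_def)
    qed
    then have bdd: "bdd_above (\<pi> \<alpha> ` lists {1..K})" by (intro bdd_aboveI2)
    have "finite_memory (\<pi>0 \<alpha>) (\<Psi> \<alpha>) S0 xs \<le> 1 - c" if "xs \<in> lists {1..K}" for xs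
      using cSUP_upper[OF that bdd] elim(2) model[OF elim(1)] by simp
    then show ?case
      using S0 pi0[OF elim(1)] Psi[OF elim(1)] c Xi1[OF elim(1)] Xi2[OF elim(1)] len[OF elim(1)]
      unfolding finite_memory_block_def by auto
  qed
  have ln_large: "?ev (\<lambda>\<alpha>. C \<le> \<epsilon> * \<bar>ln \<alpha>\<bar>)" if "0 < \<epsilon>" for C \<epsilon> :: real
  proof -
    have "?ev (\<lambda>\<alpha>. ln \<alpha> < - (C / \<epsilon>))"
      using ln_at_0 by (simp add: filterlim_at_bot_dense)
    then show ?thesis
    proof eventually_elim
      case (elim \<alpha>)
      then have "C / \<epsilon> \<le> \<bar>ln \<alpha>\<bar>" by linarith
      then show ?case using that by (simp add: divide_le_eq mult.commute)
    qed
  qed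
  {
    assume "(\<lambda>\<alpha>. real (max (max (length (\<Xi>1 \<alpha>)) (length (\<Xi>2 \<alpha>))) (length (z0 \<alpha>))))
          \<in> O[at_right 0](\<lambda>_. 1)"
    then obtain C where C:
      "?ev (\<lambda>\<alpha>. norm (real (max (max (length (\<Xi>1 \<alpha>)) (length (\<Xi>2 \<alpha>))) (length (z0 \<alpha>)))) \<le> C * norm (1 :: real))"
      by (elim landau_o.bigE)
    define L where "L = nat \<lfloor>C\<rfloor>"
    have lens: "?ev (\<lambda>\<alpha>. length (\<Xi>1 \<alpha>) \<le> L \<and> length (\<Xi>2 \<alpha>) \<le> L \<and> length (z0 \<alpha>) \<le> L)"
      using C by eventually_elim (simp add: L_def le_nat_floor)
    show "(\<lambda>\<alpha>. max (block_d K (\<pi> \<alpha>) (\<Xi>1 \<alpha>)) (block_d K (\<pi> \<alpha>) (\<Xi>2 \<alpha>))) \<in> O[at_right 0](\<lambda>_. 1)"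
    proof (rule bigoI[where c = "- ln c"])
      show "?ev (\<lambda>\<alpha>. norm (max (block_d K (\<pi> \<alpha>) (\<Xi>1 \<alpha>)) (block_d K (\<pi> \<alpha>) (\<Xi>2 \<alpha>)))
          \<le> - ln c * norm (1 :: real))"
        using in01 blocks
      proof eventually_elim
        case (elim \<alpha>)
        then interpret B1: finite_memory_block K \<kappa> S0 "\<pi>0 \<alpha>" "\<Psi> \<alpha>" c "\<Xi>1 \<alpha>" by simp
        from elim interpret B2: finite_memory_block K \<kappa> S0 "\<pi>0 \<alpha>" "\<Psi> \<alpha>" c "\<Xi>2 \<alpha>" by simp
        show ?case
          using B1.d_bounds B2.d_bounds
          by (simp add: model[OF elim(1)] B1.block_d_eq B2.block_d_eq)
      qed
    qed
    show "(\<lambda>\<alpha>. real (max (block_M K (\<pi> \<alpha>) (\<Xi>1 \<alpha>) \<epsilon>) (block_M K (\<pi> \<alpha>) (\<Xi>2 \<alpha>) \<epsilon>)))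
            \<in> o[at_right 0](\<lambda>\<alpha>. \<bar>ln \<alpha>\<bar>)" if "\<epsilon> \<in> {0<..<1}" for \<epsilon>
    proof (rule landau_o.smallI)
      fix b :: real assume "0 < b"
      show "?ev (\<lambda>\<alpha>. norm (real (max (block_M K (\<pi> \<alpha>) (\<Xi>1 \<alpha>) \<epsilon>) (block_M K (\<pi> \<alpha>) (\<Xi>2 \<alpha>) \<epsilon>)))
          \<le> b * norm \<bar>ln \<alpha>\<bar>)"
        using in01 blocks lens ln_large[OF \<open>0 < b\<close>, of "2 * real L * (- ln c) / \<epsilon> + 2"]
      proof eventually_elim
        case (elim \<alpha>)
        then interpret B1: finite_memory_block K \<kappa> S0 "\<pi>0 \<alpha>" "\<Psi> \<alpha>" c "\<Xi>1 \<alpha>" by simp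
        from elim interpret B2: finite_memory_block K \<kappa> S0 "\<pi>0 \<alpha>" "\<Psi> \<alpha>" c "\<Xi>2 \<alpha>" by simp
        have "2 * real n * (- ln c) / \<epsilon> + 2 \<le> b * \<bar>ln \<alpha>\<bar>" if "n \<le> L" for n
        proof -
          have "2 * real n * (- ln c) / \<epsilon> \<le> 2 * real L * (- ln c) / \<epsilon>"
            using that c \<open>\<epsilon> \<in> {0<..<1}\<close> by (intro divide_right_mono mult_right_mono) auto
          then show ?thesis using elim(4) by linarith
        qed
        then show ?case
          using elim(3) that B1.block_M_le[of \<epsilon>] B2.block_M_le[of \<epsilon>] model[OF elim(1)]
          by (simp add: of_nat_max) (meson order_trans)
      qed
    qed
    show "(\<lambda>\<alpha>. real (max (length (\<Xi>1 \<alpha>)) (length (\<Xi>2 \<alpha>)))) \<in> O[at_right 0](\<lambda>\<alpha>. \<bar>ln \<alpha>\<bar>)"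
    proof (rule bigoI[where c = 1])
      show "?ev (\<lambda>\<alpha>. norm (real (max (length (\<Xi>1 \<alpha>)) (length (\<Xi>2 \<alpha>)))) \<le> 1 * norm \<bar>ln \<alpha>\<bar>)"
        using lens ln_large[OF zero_less_one, of "real L"] by eventually_elim auto
    qed
    show "smallo_ereal (at_right 0)
          (\<lambda>\<alpha>. \<bar>log_ereal (ereal (block_zeta K (\<pi> \<alpha>) (\<Xi>1 \<alpha>)))\<bar>
             + log_ereal (enn2ereal (block_lambda_tilde K (\<pi> \<alpha>) (\<Xi>1 \<alpha>))))
          (\<lambda>\<alpha>. enn2ereal (block_lambda (\<pi> \<alpha>) (z0 \<alpha>) (\<Xi>1 \<alpha>)) + ereal \<bar>ln \<alpha>\<bar>)"
      unfolding smallo_ereal_def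
    proof (intro allI impI)
      fix \<epsilon> :: real assume \<epsilon>: "0 < \<epsilon>"
      show "?ev (\<lambda>\<alpha>. \<bar>\<bar>log_ereal (ereal (block_zeta K (\<pi> \<alpha>) (\<Xi>1 \<alpha>)))\<bar>
             + log_ereal (enn2ereal (block_lambda_tilde K (\<pi> \<alpha>) (\<Xi>1 \<alpha>)))\<bar>
          \<le> ereal \<epsilon> * \<bar>enn2ereal (block_lambda (\<pi> \<alpha>) (z0 \<alpha>) (\<Xi>1 \<alpha>)) + ereal \<bar>ln \<alpha>\<bar>\<bar>)"
        using in01 blocks lens
          ln_large[OF \<epsilon>, of "ln (2 * real L + 1) - 2 * ln (\<epsilon> * c ^ (2 * L + 2) / 2)"]
      proof eventually_elim
        case (elim \<alpha>)
        then interpret finite_memory_block K \<kappa> S0 "\<pi>0 \<alpha>" "\<Psi> \<alpha>" c "\<Xi>1 \<alpha>" by simp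
        show ?case
          unfolding model[OF elim(1)]
          by (rule log_sum_le[of "z0 \<alpha>" L]) (use elim \<epsilon> z0[OF elim(1)] in auto)
      qed
    qed
  }
  fix \<alpha> z0' \<Xi>1' \<Xi>2'
  assume "optimal_choice K \<kappa> (\<lambda>x. KL_info \<mu> (g x) (f x)) (\<Psi> \<alpha>) S0 z0' \<Xi>1' \<Xi>2'"
  from optimal_choice_lengths_le[OF S0 this]
  show "length z0' \<le> K ^ \<kappa>" "length \<Xi>1' \<le> K ^ \<kappa>" "length \<Xi>2' \<le> K ^ \<kappa>" by auto
qed

end
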